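(* Let $k,\gamma,\delta\in\mathbb{R}$ satisfy $$\gamma+\delta>2|k|.$$ Then the zero solution of the scalar delay differential equation $$\dot z(t)=-(\gamma+\delta)z(t)+|k|\,z(t-\tau_1)+|k|\,z(t-\tau_1-\tau_2)$$ is asymptotically stable for all $\tau_1,\tau_2\ge 0$. Consequently, if in addition $\gamma\ge 0$, then for all $\tau_1,\tau_2\ge0$ and all solutions $x_1$ (master) and $x_2$ (slave) of $$\dot x_1(t)=-\gamma x_1(t)+k\sin(x_1(t-\tau_1))-k e^{-\gamma\tau_2}\sin(x_1(t-\tau_1-\tau_2)),$$ $$\dot x_2(t)=-\gamma x_2(t)+k\sin(x_2(t-\tau_1))-k e^{-\gamma\tau_2}\sin(x_2(t-\tau_1-\tau_2))+\delta\,(x_1(t)-x_2(t)),$$ for $t\ge 0$, the synchronization error $e(t)=x_1(t)-x_2(t)$ satisfies $$\lim_{t\to\infty}e(t)=0,$$ i.e. complete synchronization is achieved.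
   Context: Solutions of the delay equations are taken for $t\ge0$ with arbitrary continuous initial histories prescribed on $[-(\tau_1+\tau_2),0]$ (the histories of $x_1$ and $x_2$ may be different). The zero solution of a linear delay differential equation is called asymptotically stable if all roots $\lambda\in\mathbb{C}$ of its characteristic equation (obtained by substituting $z(t)=e^{\lambda t}$) satisfy $\operatorname{Re}\lambda<0$. Complete synchronization means $x_1(t)-x_2(t)\to0$ as $t\to\infty$. *)

theory Defs
  imports "HOL-Analysis.Analysis"
begin

text \<open>
  A delay equation is represented by its right-hand side \<open>F\<close>: the equation is
  \<open>x'(t) = F x t\<close>, where \<open>F x t\<close> may use the values of \<open>x\<close> on \<open>[t - r, t]\<close>. The restriction of
  \<open>x\<close> to \<open>[-r, 0]\<close> is an arbitrary continuous history, so \<open>x\<close> need not be differentiable there;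
  the derivative at \<open>0\<close> is the right-hand one. Values of \<open>x\<close> before \<open>-r\<close> are irrelevant.
\<close>

definition dde_solution :: "real \<Rightarrow> ((real \<Rightarrow> real) \<Rightarrow> real \<Rightarrow> real) \<Rightarrow> (real \<Rightarrow> real) \<Rightarrow> bool" where
  "dde_solution r F x \<longleftrightarrow>
     continuous_on {-r..} x \<and>
     (\<forall>t\<ge>0. (x has_real_derivative F x t) (at t within {0..}))"

text \<open>
  For a linear autonomous delay equation \<open>z'(t) = F z t\<close>, \<open>\<mu>\<close> is a root of the characteristic
  equation if substituting \<open>z(t) = exp (\<mu> t)\<close> satisfies the equation. As \<open>\<mu>\<close> is complex,
  \<open>F\<close> is the complexified right-hand side. The notions below are only meant for linear
  autonomous \<open>F\<close>.
\<close>

definition characteristic_root :: "((real \<Rightarrow> complex) \<Rightarrow> real \<Rightarrow> complex) \<Rightarrow> complex \<Rightarrow> bool" where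
  "characteristic_root F \<mu> \<longleftrightarrow>
     (\<forall>t. ((\<lambda>s. exp (\<mu> * of_real s)) has_vector_derivative F (\<lambda>s. exp (\<mu> * of_real s)) t) (at t))"

definition zero_asymptotically_stable :: "((real \<Rightarrow> complex) \<Rightarrow> real \<Rightarrow> complex) \<Rightarrow> bool" where
  "zero_asymptotically_stable F \<longleftrightarrow> (\<forall>\<mu>. characteristic_root F \<mu> \<longrightarrow> Re \<mu> < 0)"

text \<open>The characteristic equation in its usual explicit form, for two delays.\<close>

lemma characteristic_root_two_delays:
  fixes a b c r s :: real
  shows "characteristic_root (\<lambda>z t. a *\<^sub>R z t + b *\<^sub>R z (t - r) + c *\<^sub>R z (t - r - s)) \<mu> \<longleftrightarrow>
    \<mu> = of_real a + of_real b * exp (- \<mu> * of_real r) + of_real c * exp (- \<mu> * of_real (r + s))"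
    (is "?L \<longleftrightarrow> \<mu> = ?R")
proof -
  let ?E = "\<lambda>t. exp (\<mu> * complex_of_real t)"
  have D: "(?E has_vector_derivative \<mu> * ?E t) (at t)" for t
  proof -
    have "((\<lambda>w. exp (\<mu> * w)) has_field_derivative \<mu> * ?E t) (at (of_real t))"
      by (auto intro!: derivative_eq_intros)
    then show ?thesis
      by (rule has_vector_derivative_real_field)
  qed
  have F: "a *\<^sub>R ?E t + b *\<^sub>R ?E (t - r) + c *\<^sub>R ?E (t - r - s) = ?R * ?E t" for t
  proof -
    have "?E (t - r) = exp (- \<mu> * of_real r) * ?E t"
         "?E (t - r - s) = exp (- \<mu> * of_real (r + s)) * ?E t"
      by (simp_all add: exp_add [symmetric] algebra_simps)
    then show ?thesis
      by (simp only: scaleR_conv_of_real distrib_right mult.assoc)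
  qed
  have "?L \<longleftrightarrow> (\<forall>t. (?E has_vector_derivative ?R * ?E t) (at t))"
    by (simp only: characteristic_root_def F)
  also have "\<dots> \<longleftrightarrow> (\<forall>t. \<mu> * ?E t = ?R * ?E t)"
    using D vector_derivative_unique_at by metis
  also have "\<dots> \<longleftrightarrow> \<mu> = ?R"
    by (simp only: mult_cancel_right exp_not_eq_zero) simp
  finally show ?thesis .
qed

end

theory Submission
  imports Defs
begin

text \<open>
  Both halves say that an instantaneous damping of rate \<open>c = \<gamma> + \<delta>\<close> beats delayed feedback of total
  gain \<open>2\<bar>k\<bar> < c\<close>, however long the delays are.

  For the characteristic equation \<open>\<mu> = - c + \<bar>k\<bar> exp (- \<mu> \<tau>\<^sub>1) + \<bar>k\<bar> exp (- \<mu> (\<tau>\<^sub>1 + \<tau>\<^sub>2))\<close> this is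
  immediate: if \<open>Re \<mu> \<ge> 0\<close>, then both exponentials have modulus at most \<open>1\<close>, so the real part of
  the right-hand side is at most \<open>2\<bar>k\<bar> - c < 0\<close>.

  The synchronization error solves a nonlinear equation, so its decay is not read off from
  characteristic roots. Instead it is derived from a form of Halanay's inequality
  (\<open>halanay_exponential_decay\<close>). Subtracting the two equations gives \<open>e' = - c e + g\<close>; as \<open>sin\<close> is
  1-Lipschitz and \<open>exp (- \<gamma> \<tau>\<^sub>2) \<le> 1\<close> (this is where \<open>\<gamma> \<ge> 0\<close> enters), \<open>\<bar>g(t)\<bar>\<close> is at most \<open>2\<bar>k\<bar>\<close>
  times the maximum of \<open>\<bar>e\<bar>\<close> over the delay window ending at \<open>t\<close>. Choose \<open>\<eta> > 0\<close> so small that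
  \<open>\<eta> + 2\<bar>k\<bar> exp (\<eta> (\<tau>\<^sub>1 + \<tau>\<^sub>2)) < c\<close>. An envelope \<open>M exp (- \<eta> t)\<close> that strictly dominates \<open>\<bar>e\<bar>\<close> on
  the initial history can then never be reached: at a first contact \<open>\<bar>e\<bar>\<close> would be falling
  strictly faster than the envelope.
\<close>

section \<open>Halanay's inequality\<close>

text \<open>
  The gap in \<open>b < c\<close> leaves room for a positive decay rate, by continuity at rate \<open>0\<close>.
\<close>

lemma halanay_rate_exists:
  fixes b c r :: real
  assumes "b < c"
  obtains \<eta> where "\<eta> > 0" "\<eta> + b * exp (\<eta> * r) < c"
proof -
  have "((\<lambda>\<eta>. \<eta> + b * exp (\<eta> * r)) \<longlongrightarrow> 0 + b * exp (0 * r)) (at_right 0)"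
    by (intro tendsto_intros)
  then have "\<forall>\<^sub>F \<eta> in at_right 0. \<eta> + b * exp (\<eta> * r) < c"
    using assms by (intro order_tendstoD(2)) auto
  moreover have "\<forall>\<^sub>F \<eta> in at_right (0::real). \<eta> > 0"
    by (simp add: eventually_at_right_less)
  ultimately have "\<forall>\<^sub>F \<eta> in at_right 0. \<eta> + b * exp (\<eta> * r) < c \<and> \<eta> > 0"
    by (rule eventually_conj)
  then have "\<exists>\<eta>. \<eta> + b * exp (\<eta> * r) < c \<and> \<eta> > 0"
    by (rule eventually_happens' [OF trivial_limit_at_right_real])
  then show ?thesis
    using that by blast
qed

text \<open>
  The times in \<open>{a..t}\<close> with \<open>M \<le> \<bar>u\<bar>\<close> form a nonempty compact set, so there is a least one; the
  intermediate value theorem rules out that \<open>\<bar>u\<bar>\<close> jumps past \<open>M\<close> there.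
\<close>

lemma first_time_abs_eq:
  fixes u :: "real \<Rightarrow> real"
  assumes cont: "continuous_on {a..} u"
    and start: "\<bar>u a\<bar> < M" and exit: "a \<le> t" "M \<le> \<bar>u t\<bar>"
  obtains T where "a < T" "\<bar>u T\<bar> = M" "\<And>s. a \<le> s \<Longrightarrow> s < T \<Longrightarrow> \<bar>u s\<bar> < M"
proof -
  define S where "S = {s \<in> {a..t}. M \<le> \<bar>u s\<bar>}"
  have contab: "continuous_on {a..s} (\<lambda>s. \<bar>u s\<bar>)" for s
    by (intro continuous_on_rabs continuous_on_subset [OF cont]) auto
  have "closed S"
    unfolding S_def by (intro continuous_on_closed_Collect_le contab continuous_intros closed_atLeastAtMost)
  moreover have "bounded S"
    by (rule bounded_subset [OF bounded_closed_interval [of a t]]) (auto simp: S_def)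
  ultimately have "compact S"
    by (simp add: compact_eq_bounded_closed)
  moreover have "t \<in> S"
    using exit by (simp add: S_def)
  ultimately obtain T where T: "T \<in> S" "\<And>s. s \<in> S \<Longrightarrow> T \<le> s"
    by (metis compact_attains_inf empty_iff)
  have before: "\<bar>u s\<bar> < M" if "a \<le> s" "s < T" for s
    using T that by (force simp: S_def not_le)
  obtain s where s: "a \<le> s" "s \<le> T" "\<bar>u s\<bar> = M"
    using IVT' [of "\<lambda>s. \<bar>u s\<bar>" a M T] T(1) start contab by (auto simp: S_def)
  then have "s = T"
    using before [of s] by fastforce
  with s start have "a < T" "\<bar>u T\<bar> = M"
    by (auto simp: less_le)
  with before show ?thesis
    by (rule that[rotated 2])
qed

text \<open>
  The hypothesis \<open>g\<close> is the estimate \<open>\<bar>g t\<bar> \<le> b * (SUP s\<in>{t - r..t}. \<bar>e s\<bar>)\<close>, phrased with an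
  arbitrary bound in place of the supremum, so that any combination of delays inside the window is
  covered.
\<close>

lemma halanay_exponential_decay:
  fixes e g :: "real \<Rightarrow> real"
  assumes r: "0 \<le> r" and b: "0 \<le> b" "b < c"
    and cont: "continuous_on {-r..} e"
    and deriv: "\<And>t. 0 \<le> t \<Longrightarrow> (e has_real_derivative - c * e t + g t) (at t within {0..})"
    and g: "\<And>t K. 0 \<le> t \<Longrightarrow> (\<And>s. t - r \<le> s \<Longrightarrow> s \<le> t \<Longrightarrow> \<bar>e s\<bar> \<le> K) \<Longrightarrow> \<bar>g t\<bar> \<le> b * K"
  obtains \<eta> M where "\<eta> > 0" "\<And>t. 0 \<le> t \<Longrightarrow> \<bar>e t\<bar> \<le> M * exp (- \<eta> * t)"
proof -
  obtain \<eta> where \<eta>: "\<eta> > 0" "\<eta> + b * exp (\<eta> * r) < c"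
    using halanay_rate_exists [OF b(2)] .
  have "compact (e ` {-r..0})"
    by (intro compact_continuous_image continuous_on_subset [OF cont]) auto
  then obtain M where "M > 0" and hist': "\<forall>y\<in>e ` {-r..0}. norm y < M"
    using compact_imp_bounded bounded_pos_less by metis
  then have hist: "\<bar>e s\<bar> < M" if "-r \<le> s" "s \<le> 0" for s
    using that by auto

  define u where "u t = exp (\<eta> * t) * e t" for t
  have u_abs: "\<bar>u t\<bar> = exp (\<eta> * t) * \<bar>e t\<bar>" for t
    by (simp add: u_def abs_mult)
  have u_deriv: "(u has_real_derivative (\<eta> - c) * u t + exp (\<eta> * t) * g t) (at t within {0..})"
    if "0 \<le> t" for t
  proof -
    have "((\<lambda>t. exp (\<eta> * t)) has_real_derivative \<eta> * exp (\<eta> * t)) (at t within {0..})"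
      by (auto intro!: derivative_eq_intros)
    from DERIV_mult [OF this deriv [OF that]] show ?thesis
      unfolding u_def by (rule DERIV_cong) (simp add: algebra_simps)
  qed

  have cont_u: "continuous_on {0..} u"
    unfolding u_def using r
    by (intro continuous_intros continuous_on_subset [OF cont]) auto
  have u0: "\<bar>u 0\<bar> < M"
    using hist [of 0] r by (simp add: u_def)
  have "\<bar>u t\<bar> < M" if t: "0 \<le> t" for t
  proof (rule ccontr)
    assume "\<not> \<bar>u t\<bar> < M"
    then have "M \<le> \<bar>u t\<bar>"
      by simp
    with cont_u u0 t obtain T where T: "0 < T" "\<bar>u T\<bar> = M"
      and before: "\<And>s. 0 \<le> s \<Longrightarrow> s < T \<Longrightarrow> \<bar>u s\<bar> < M"
      by (rule first_time_abs_eq) blast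

    \<comment> \<open>Looking back by at most \<open>r\<close>, the envelope is larger than at \<open>T\<close> by at most \<open>exp (\<eta> * r)\<close>,
       the factor that the choice of \<open>\<eta>\<close> allows for.\<close>
    have "\<bar>e s\<bar> \<le> M * exp (\<eta> * r) * exp (- \<eta> * T)" if "T - r \<le> s" "s \<le> T" for s
    proof -
      have "\<bar>e s\<bar> \<le> M * exp (- \<eta> * s)"
      proof (cases "0 \<le> s")
        case True
        then have "exp (\<eta> * s) * \<bar>e s\<bar> \<le> M"
          using before [of s] T(2) \<open>s \<le> T\<close> u_abs [of s] by (cases "s = T") auto
        then show ?thesis
          by (simp add: exp_minus field_simps)
      next
        case False
        then have "\<bar>e s\<bar> \<le> M"
          using hist [of s] that T(1) by simp
        also have "M \<le> M * exp (- \<eta> * s)"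
          using False \<eta>(1) \<open>M > 0\<close> by (simp add: mult_nonneg_nonpos)
        finally show ?thesis .
      qed
      also have "\<dots> \<le> M * exp (\<eta> * r + - \<eta> * T)"
        using \<eta>(1) \<open>M > 0\<close> mult_left_mono [of "T - r" s \<eta>] that by (simp add: algebra_simps)
      finally show ?thesis
        by (simp only: exp_add mult.assoc)
    qed
    then have "\<bar>g T\<bar> \<le> b * (M * exp (\<eta> * r) * exp (- \<eta> * T))"
      using T(1) by (intro g) auto
    then have gT: "exp (\<eta> * T) * \<bar>g T\<bar> \<le> b * M * exp (\<eta> * r)"
      by (simp add: exp_minus field_simps)

    \<comment> \<open>Reflecting \<open>e\<close> if necessary, the contact is with the upper edge of the band.\<close>
    define v where "v s = sgn (u T) * u s" for s
    have vT: "v T = M"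
      using T(2) by (simp add: v_def abs_sgn mult.commute)
    have sgn1: "\<bar>sgn (u T)\<bar> = 1"
      using T(2) \<open>M > 0\<close> by (auto simp: sgn_if)
    let ?D = "sgn (u T) * ((\<eta> - c) * u T + exp (\<eta> * T) * g T)"
    have "(v has_real_derivative ?D) (at T within {0..})"
      unfolding v_def using T(1) by (intro DERIV_cmult u_deriv) simp
    moreover have "?D < 0"
    proof -
      have "?D = (\<eta> - c) * M + sgn (u T) * (exp (\<eta> * T) * g T)"
        using vT by (simp add: v_def algebra_simps)
      also have "\<dots> \<le> (\<eta> - c) * M + exp (\<eta> * T) * \<bar>g T\<bar>"
        using abs_ge_self [of "sgn (u T) * (exp (\<eta> * T) * g T)"] sgn1 by (simp add: abs_mult)
      also have "\<dots> \<le> (\<eta> + b * exp (\<eta> * r) - c) * M"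
        using gT by (simp add: algebra_simps)
      also have "\<dots> < 0"
        using \<eta>(2) \<open>M > 0\<close> by (simp add: mult_neg_pos)
      finally show ?thesis .
    qed
    ultimately obtain d where d: "d > 0"
      and dec: "\<And>h. h > 0 \<Longrightarrow> T - h \<in> {0..} \<Longrightarrow> h < d \<Longrightarrow> v T < v (T - h)"
      using has_real_derivative_neg_dec_left by blast
    define h where "h = min T (d / 2)"
    have h: "0 < h" "h \<le> T" "h < d"
      using T(1) d by (auto simp: h_def min_def)
    have "M < v (T - h)"
      using dec [of h] h vT by simp
    also have "\<dots> \<le> \<bar>u (T - h)\<bar>"
      using abs_ge_self [of "v (T - h)"] sgn1 by (simp add: v_def abs_mult)
    also have "\<dots> < M"
      using before [of "T - h"] h by simp
    finally show False .
  qed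
  then have "\<bar>e t\<bar> \<le> M * exp (- \<eta> * t)" if "0 \<le> t" for t
    using that u_abs [of t] by (force simp: exp_minus field_simps)
  with \<eta>(1) show ?thesis
    by (rule that)
qed

section \<open>Characteristic roots and synchronization\<close>

lemma two_delay_characteristic_roots_stable:
  fixes a c r s :: real
  assumes "0 \<le> a" "2 * a < c" "0 \<le> r" "0 \<le> s"
  shows "zero_asymptotically_stable (\<lambda>z t. - c *\<^sub>R z t + a *\<^sub>R z (t - r) + a *\<^sub>R z (t - r - s))"
  unfolding zero_asymptotically_stable_def characteristic_root_two_delays
proof (intro allI impI, rule ccontr)
  fix \<mu> :: complex
  assume \<mu>: "\<mu> = of_real (- c) + of_real a * exp (- \<mu> * of_real r)
                + of_real a * exp (- \<mu> * of_real (r + s))"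
    and "\<not> Re \<mu> < 0"
  have bound: "Re (exp (- \<mu> * of_real q)) \<le> 1" if "0 \<le> q" for q
  proof -
    have "Re (exp (- \<mu> * of_real q)) \<le> norm (exp (- \<mu> * of_real q))"
      by (rule complex_Re_le_cmod)
    also have "\<dots> \<le> 1"
      using that \<open>\<not> Re \<mu> < 0\<close> by simp
    finally show ?thesis .
  qed
  have "Re \<mu> = - c + a * Re (exp (- \<mu> * of_real r)) + a * Re (exp (- \<mu> * of_real (r + s)))"
    by (subst \<mu>) simp
  also have "\<dots> \<le> - c + a * 1 + a * 1"
    using assms by (intro add_mono mult_left_mono bound) auto
  finally show False
    using assms \<open>\<not> Re \<mu> < 0\<close> by simp
qed

lemma abs_sin_diff_le: "\<bar>sin x - sin y\<bar> \<le> \<bar>x - y\<bar>" for x y :: real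
proof -
  have "\<bar>sin x - sin y\<bar> = 2 * \<bar>sin ((x - y) / 2)\<bar> * \<bar>cos ((x + y) / 2)\<bar>"
    by (simp add: sin_diff_sin abs_mult)
  also have "\<dots> \<le> 2 * \<bar>(x - y) / 2\<bar> * 1"
    by (intro mult_mono abs_sin_le_one abs_cos_le_one abs_sin_x_le_abs_x) auto
  finally show ?thesis
    by simp
qed

lemma synchronization_error_tendsto_0:
  fixes k \<gamma> \<delta> \<tau>1 \<tau>2 :: real
  assumes gain: "2 * \<bar>k\<bar> < \<gamma> + \<delta>" and "0 \<le> \<gamma>" "0 \<le> \<tau>1" "0 \<le> \<tau>2"
    and master: "dde_solution (\<tau>1 + \<tau>2)
      (\<lambda>x t. - \<gamma> * x t + k * sin (x (t - \<tau>1)) - k * exp (- \<gamma> * \<tau>2) * sin (x (t - \<tau>1 - \<tau>2))) x1"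
    and slave: "dde_solution (\<tau>1 + \<tau>2)
      (\<lambda>x t. - \<gamma> * x t + k * sin (x (t - \<tau>1)) - k * exp (- \<gamma> * \<tau>2) * sin (x (t - \<tau>1 - \<tau>2))
              + \<delta> * (x1 t - x t)) x2"
  shows "((\<lambda>t. x1 t - x2 t) \<longlongrightarrow> 0) at_top"
proof -
  define e where "e t = x1 t - x2 t" for t
  define g where "g t = k * (sin (x1 (t - \<tau>1)) - sin (x2 (t - \<tau>1)))
    - k * exp (- \<gamma> * \<tau>2) * (sin (x1 (t - \<tau>1 - \<tau>2)) - sin (x2 (t - \<tau>1 - \<tau>2)))" for t
  have cont: "continuous_on {- (\<tau>1 + \<tau>2)..} e"
    using master slave unfolding e_def dde_solution_def by (intro continuous_on_diff) auto
  have deriv: "(e has_real_derivative - (\<gamma> + \<delta>) * e t + g t) (at t within {0..})" if "0 \<le> t" for t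
  proof -
    have "(x1 has_real_derivative (- \<gamma> * x1 t + k * sin (x1 (t - \<tau>1))
             - k * exp (- \<gamma> * \<tau>2) * sin (x1 (t - \<tau>1 - \<tau>2)))) (at t within {0..})"
      using master that by (simp add: dde_solution_def)
    moreover have "(x2 has_real_derivative (- \<gamma> * x2 t + k * sin (x2 (t - \<tau>1))
             - k * exp (- \<gamma> * \<tau>2) * sin (x2 (t - \<tau>1 - \<tau>2)) + \<delta> * (x1 t - x2 t))) (at t within {0..})"
      using slave that by (simp add: dde_solution_def)
    ultimately have "(e has_real_derivative
        (- \<gamma> * x1 t + k * sin (x1 (t - \<tau>1)) - k * exp (- \<gamma> * \<tau>2) * sin (x1 (t - \<tau>1 - \<tau>2)))
        - (- \<gamma> * x2 t + k * sin (x2 (t - \<tau>1)) - k * exp (- \<gamma> * \<tau>2) * sin (x2 (t - \<tau>1 - \<tau>2))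
           + \<delta> * (x1 t - x2 t))) (at t within {0..})"
      unfolding e_def by (rule DERIV_diff)
    then show ?thesis
      by (rule DERIV_cong) (simp add: e_def g_def algebra_simps)
  qed
  have g_bound: "\<bar>g t\<bar> \<le> 2 * \<bar>k\<bar> * K"
    if K: "\<And>s. t - (\<tau>1 + \<tau>2) \<le> s \<Longrightarrow> s \<le> t \<Longrightarrow> \<bar>e s\<bar> \<le> K" for t K
  proof -
    have sinK: "\<bar>sin (x1 s) - sin (x2 s)\<bar> \<le> K" if "t - (\<tau>1 + \<tau>2) \<le> s" "s \<le> t" for s
      using K [OF that] abs_sin_diff_le [of "x1 s" "x2 s"] by (simp add: e_def)
    have "\<bar>g t\<bar> \<le> \<bar>k\<bar> * \<bar>sin (x1 (t - \<tau>1)) - sin (x2 (t - \<tau>1))\<bar>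
        + \<bar>k\<bar> * exp (- \<gamma> * \<tau>2) * \<bar>sin (x1 (t - \<tau>1 - \<tau>2)) - sin (x2 (t - \<tau>1 - \<tau>2))\<bar>"
      unfolding g_def by (rule order_trans [OF abs_triangle_ineq4]) (simp add: abs_mult)
    also have "\<dots> \<le> \<bar>k\<bar> * K + \<bar>k\<bar> * 1 * K"
      using assms(2-4) by (intro add_mono mult_mono sinK) auto
    finally show ?thesis
      by (simp add: mult.commute)
  qed
  have "0 \<le> \<tau>1 + \<tau>2" "0 \<le> 2 * \<bar>k\<bar>"
    using assms by auto
  then obtain \<eta> M where "\<eta> > 0" and decay: "\<And>t. 0 \<le> t \<Longrightarrow> \<bar>e t\<bar> \<le> M * exp (- \<eta> * t)"
    by (rule halanay_exponential_decay [OF _ _ gain cont deriv g_bound]) blast+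
  have "filterlim (\<lambda>t. - \<eta> * t) at_bot at_top"
    using \<open>\<eta> > 0\<close>
    by (intro filterlim_tendsto_neg_mult_at_bot [OF tendsto_const _ filterlim_ident]) simp
  then have "((\<lambda>t. M * exp (- \<eta> * t)) \<longlongrightarrow> 0) at_top"
    by (intro tendsto_mult_right_zero filterlim_compose [OF exp_at_bot])
  moreover have "\<forall>\<^sub>F t in at_top. norm (e t) \<le> M * exp (- \<eta> * t)"
    using eventually_ge_at_top [of 0] by eventually_elim (simp only: real_norm_def decay)
  ultimately have "(e \<longlongrightarrow> 0) at_top"
    by (rule Lim_null_comparison[rotated])
  then show ?thesis
    by (simp add: e_def [abs_def])
qed

theorem theorem8p1:
  fixes k \<gamma> \<delta> :: real
  assumes "\<gamma> + \<delta> > 2 * \<bar>k\<bar>"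
  shows "(\<forall>\<tau>1\<ge>0. \<forall>\<tau>2\<ge>0.
            zero_asymptotically_stable
              (\<lambda>z t. - (\<gamma> + \<delta>) *\<^sub>R z t + \<bar>k\<bar> *\<^sub>R z (t - \<tau>1) + \<bar>k\<bar> *\<^sub>R z (t - \<tau>1 - \<tau>2))) \<and>
         (\<gamma> \<ge> 0 \<longrightarrow>
           (\<forall>\<tau>1\<ge>0. \<forall>\<tau>2\<ge>0. \<forall>x1 x2.
              dde_solution (\<tau>1 + \<tau>2)
                (\<lambda>x t. - \<gamma> * x t + k * sin (x (t - \<tau>1))
                        - k * exp (- \<gamma> * \<tau>2) * sin (x (t - \<tau>1 - \<tau>2))) x1 \<and>
              dde_solution (\<tau>1 + \<tau>2)
                (\<lambda>x t. - \<gamma> * x t + k * sin (x (t - \<tau>1))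
                        - k * exp (- \<gamma> * \<tau>2) * sin (x (t - \<tau>1 - \<tau>2))
                        + \<delta> * (x1 t - x t)) x2 \<longrightarrow>
              ((\<lambda>t. x1 t - x2 t) \<longlongrightarrow> 0) at_top))"
  using assms two_delay_characteristic_roots_stable [of "\<bar>k\<bar>" "\<gamma> + \<delta>"]
    synchronization_error_tendsto_0 [of k \<gamma> \<delta>]
  by (intro conjI allI impI) auto

end
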